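(* Let $n \geq 12$ and $d \geq 2$ be integers and let $P \in \mathcal{P}_d$. Let $\widehat P_n = (\widehat p_1, \dots, \widehat p_d)$ be the Laplace estimator, defined by $\widehat p_j = \frac{N_j+1}{n+d}$ for $j=1,\dots,d$. Then for any $\delta \in (e^{-n/6}, e^{-2})$, $$\mathbb{P}_P\bigg( \mathrm{KL}(P, \widehat P_n) \geq 110000 \, \frac{d + \log(1/\delta)\log\log(1/\delta)}{n} \bigg) \leq 4\delta .$$
   Context: $\mathcal{P}_d$ is the set of probability vectors $P=(p_1,\dots,p_d)$ (with $p_j\ge 0$, $\sum_j p_j=1$), identified with probability distributions on $\{1,\dots,d\}$. $X_1,\dots,X_n$ are i.i.d. with distribution $P$, $\mathbb{P}_P$ is probability under this law, and $N_j=\sum_{i=1}^n \mathbf{1}(X_i=j)$. For $P,Q\in\mathcal{P}_d$, $\mathrm{KL}(P,Q)=\sum_{j=1}^d p_j\log(p_j/q_j)\in[0,+\infty]$, with the convention that a term is $0$ if $p_j=0$ and $+\infty$ if $p_j>0=q_j$. $\log$ is the natural logarithm. *)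

theory Defs
  imports "HOL-Probability.Probability"
begin

(* Vectors of length d are functions on nat of which only the entries at 1, ..., d matter. *)

definition prob_vectors :: "nat \<Rightarrow> (nat \<Rightarrow> real) set" where
  "prob_vectors d = {p. (\<forall>j\<in>{1..d}. 0 \<le> p j) \<and> (\<Sum>j=1..d. p j) = 1}"

definition KL_term :: "real \<Rightarrow> real \<Rightarrow> ereal" where
  "KL_term p q = (if p = 0 then 0 else if q = 0 then \<infinity> else ereal (p * ln (p / q)))"

(* No term is -\<infinity>, so the ereal sum is unambiguous.  The library's KL_divergence is
   real-valued and so cannot express the value \<infinity>. *)
definition KL :: "nat \<Rightarrow> (nat \<Rightarrow> real) \<Rightarrow> (nat \<Rightarrow> real) \<Rightarrow> ereal" where
  "KL d p q = (\<Sum>j=1..d. KL_term (p j) (q j))"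

definition iid_sample :: "'w measure \<Rightarrow> nat \<Rightarrow> nat \<Rightarrow> (nat \<Rightarrow> real) \<Rightarrow> (nat \<Rightarrow> 'w \<Rightarrow> nat) \<Rightarrow> bool" where
  "iid_sample M d n p X \<longleftrightarrow>
     prob_space M \<and>
     prob_space.indep_vars M (\<lambda>_. count_space {1..d}) X {1..n} \<and>
     (\<forall>i\<in>{1..n}. \<forall>j\<in>{1..d}. measure M {w \<in> space M. X i w = j} = p j)"

definition num_occ :: "nat \<Rightarrow> (nat \<Rightarrow> 'w \<Rightarrow> nat) \<Rightarrow> nat \<Rightarrow> 'w \<Rightarrow> nat" where
  "num_occ n X j w = (\<Sum>i=1..n. if X i w = j then 1 else 0)"

definition laplace_estimator :: "nat \<Rightarrow> nat \<Rightarrow> (nat \<Rightarrow> 'w \<Rightarrow> nat) \<Rightarrow> 'w \<Rightarrow> nat \<Rightarrow> real" where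
  "laplace_estimator d n X w j = (real (num_occ n X j w) + 1) / (real n + real d)"

end

theory Submission
  imports Defs
begin

text \<open>
  Put \<open>\<mu>\<^sub>j = n p\<^sub>j\<close> and \<open>D(\<mu>, y) = \<mu> ln (\<mu> / y) - \<mu> + y\<close>. Since \<open>ln (1 + d / n) \<le> d / n\<close>, the quantity
  \<open>n KL(P, P')\<close>, with \<open>P'\<close> the Laplace estimator, is at most \<open>\<Sum>\<^sub>j D(\<mu>\<^sub>j, N\<^sub>j + 1)\<close>. The joint moment generating
  function of the multinomial counts is dominated by that of independent Poisson variables of means
  \<open>\<mu>\<^sub>j\<close>, so a sum of functions \<open>g\<^sub>j(N\<^sub>j)\<close> has a controlled exponential moment as soon as each \<open>exp g\<^sub>j\<close> is
  below a finite mixture of the functions \<open>exp (s x - \<mu>\<^sub>j (exp s - 1))\<close> of bounded total weight.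

  If \<open>N\<^sub>j + 1 \<ge> \<mu>\<^sub>j / 4\<close>, then \<open>D \<le> (N\<^sub>j + 1 - \<mu>\<^sub>j)\<^sup>2 / (N\<^sub>j + 1)\<close>, and a fixed multiple of this is dominated by such
  a mixture; this contributes \<open>O(d + L)\<close>, where \<open>L = ln (1 / \<delta>)\<close>. Otherwise \<open>D \<le> \<mu>\<^sub>j ln \<mu>\<^sub>j\<close>. With
  \<open>T = 4 (L + ln d)\<close>, a union bound excludes this case for all \<open>j\<close> with \<open>\<mu>\<^sub>j > T\<close>. For \<open>\<mu>\<^sub>j \<le> T\<close> the exponential
  moment at \<open>\<theta> = 1 / (10 ln T)\<close> is \<open>1 + O(\<theta>)\<close>, which contributes \<open>O(d + L ln T) = O(d + L ln L)\<close>.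
\<close>

subsection \<open>Exponential moments of multinomial counts\<close>

lemma iid_sample_values:
  assumes "iid_sample M d n p X" "i \<in> {1..n}"
  shows "X i \<in> M \<rightarrow>\<^sub>M count_space {1..d}"
proof -
  interpret prob_space M using assms(1) by (simp add: iid_sample_def)
  show ?thesis using assms unfolding iid_sample_def indep_vars_def by blast
qed

lemma num_occ_measurable:
  assumes "iid_sample M d n p X"
  shows "num_occ n X j \<in> M \<rightarrow>\<^sub>M count_space UNIV"
proof -
  have "(\<lambda>w. if X i w = j then 1 else 0 :: nat) \<in> M \<rightarrow>\<^sub>M count_space UNIV" if "i \<in> {1..n}" for i
    using measurable_compose[OF iid_sample_values[OF assms that],
        of "\<lambda>x. if x = j then 1 else 0" "count_space UNIV"] by simp
  then have "(\<lambda>w. \<Sum>i=1..n. if X i w = j then 1 else 0 :: nat) \<in> M \<rightarrow>\<^sub>M count_space UNIV"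
    by (intro measurable_sum_nat) auto
  then show ?thesis by (simp add: num_occ_def[abs_def])
qed

lemma num_occ_le: "num_occ n X j w \<le> n"
  unfolding num_occ_def by (rule order_trans[OF sum_mono[where g = "\<lambda>_. 1"]]) auto

lemma sum_num_occ:
  fixes s :: "nat \<Rightarrow> real"
  assumes "iid_sample M d n p X" "w \<in> space M"
  shows "(\<Sum>j=1..d. s j * real (num_occ n X j w)) = (\<Sum>i=1..n. s (X i w))"
proof -
  have "(\<Sum>j=1..d. s j * real (num_occ n X j w))
      = (\<Sum>j=1..d. \<Sum>i=1..n. if X i w = j then s j else 0)"
    unfolding num_occ_def of_nat_sum sum_distrib_left by (intro sum.cong) auto
  also have "\<dots> = (\<Sum>i=1..n. \<Sum>j=1..d. if X i w = j then s j else 0)"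
    by (rule sum.swap)
  also have "\<dots> = (\<Sum>i=1..n. s (X i w))"
  proof (intro sum.cong refl)
    fix i assume "i \<in> {1..n}"
    then have "X i w \<in> {1..d}"
      using measurable_space[OF iid_sample_values[OF assms(1)] assms(2)] by simp
    then show "(\<Sum>j=1..d. if X i w = j then s j else 0) = s (X i w)" by simp
  qed
  finally show ?thesis .
qed

lemma expectation_of_sample:
  fixes f :: "nat \<Rightarrow> real"
  assumes "iid_sample M d n p X" "i \<in> {1..n}"
  shows "integrable M (\<lambda>w. f (X i w))"
    and "(\<integral>w. f (X i w) \<partial>M) = (\<Sum>j=1..d. p j * f j)"
proof -
  interpret prob_space M using assms(1) by (simp add: iid_sample_def)
  have m: "X i \<in> M \<rightarrow>\<^sub>M count_space {1..d}" by (rule iid_sample_values[OF assms])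
  have s: "{w \<in> space M. X i w = j} \<in> sets M" if "j \<in> {1..d}" for j
    using measurable_sets[OF m, of "{j}"] that by (simp add: vimage_def Int_def conj_commute)
  have eq: "f (X i w) = (\<Sum>j=1..d. f j * indicator {w \<in> space M. X i w = j} w)"
    if "w \<in> space M" for w
  proof -
    have x: "X i w \<in> {1..d}" using measurable_space[OF m that] by simp
    have "(\<Sum>j=1..d. f j * indicator {w \<in> space M. X i w = j} w)
        = (\<Sum>j=1..d. if X i w = j then f j else 0)"
      using that by (intro sum.cong) (auto simp: indicator_def)
    then show ?thesis using x by simp
  qed
  have int: "integrable M (\<lambda>w. \<Sum>j=1..d. f j * indicator {w \<in> space M. X i w = j} w)"
    using s by (intro Bochner_Integration.integrable_sum integrable_mult_right integrable_real_indicator)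
      (auto simp: less_top[symmetric])
  then show "integrable M (\<lambda>w. f (X i w))"
    by (subst Bochner_Integration.integrable_cong[OF refl eq])
  have "(\<integral>w. f (X i w) \<partial>M)
      = (\<integral>w. (\<Sum>j=1..d. f j * indicator {w \<in> space M. X i w = j} w) \<partial>M)"
    using eq by (intro Bochner_Integration.integral_cong) auto
  also have "\<dots> = (\<Sum>j=1..d. \<integral>w. f j * indicator {w \<in> space M. X i w = j} w \<partial>M)"
    using s by (intro Bochner_Integration.integral_sum integrable_mult_right integrable_real_indicator)
      (auto simp: less_top[symmetric])
  also have "\<dots> = (\<Sum>j=1..d. p j * f j)"
  proof (intro sum.cong refl)
    fix j assume j: "j \<in> {1..d}"
    have "measure M {w \<in> space M. X i w = j} = p j"
      using assms j by (simp add: iid_sample_def)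
    then show "(\<integral>w. f j * indicator {w \<in> space M. X i w = j} w \<partial>M) = p j * f j"
      using s[OF j] by (simp add: Int_absorb1 subset_eq)
  qed
  finally show "(\<integral>w. f (X i w) \<partial>M) = (\<Sum>j=1..d. p j * f j)" .
qed

text \<open>Independence turns the expectation of \<open>exp (\<Sum>j. s j * N j)\<close> into
  \<open>(1 + u) ^ n\<close>, and \<open>1 + u \<le> exp u\<close> bounds this by
  \<open>exp (n * u)\<close>, the moment generating function of independent Poisson variables with
  means \<open>n * p j\<close>.\<close>

lemma multinomial_mgf_le_poisson_mgf:
  assumes iid: "iid_sample M d n p X" and p: "p \<in> prob_vectors d"
  shows "integrable M (\<lambda>w. exp (\<Sum>j=1..d. s j * real (num_occ n X j w) - real n * p j * (exp (s j) - 1)))"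
    and "(\<integral>w. exp (\<Sum>j=1..d. s j * real (num_occ n X j w) - real n * p j * (exp (s j) - 1)) \<partial>M) \<le> 1"
proof -
  interpret prob_space M using iid by (simp add: iid_sample_def)
  define u where "u = (\<Sum>j=1..d. p j * (exp (s j) - 1))"
  have nu: "(\<Sum>j=1..d. real n * p j * (exp (s j) - 1)) = real n * u"
    by (simp add: u_def sum_distrib_left mult.assoc)
  have eq: "exp (\<Sum>j=1..d. s j * real (num_occ n X j w) - real n * p j * (exp (s j) - 1))
      = exp (- (real n * u)) * (\<Prod>i=1..n. exp (s (X i w)))" if "w \<in> space M" for w
    unfolding sum_subtractf nu sum_num_occ[OF iid that] by (simp add: exp_diff exp_minus exp_sum divide_inverse)
  have ind: "indep_vars (\<lambda>_. borel) (\<lambda>i w. exp (s (X i w))) {1..n}"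
    using iid by (intro indep_vars_compose2[where M' = "\<lambda>_. count_space {1..d}"
          and Y = "\<lambda>_ x. exp (s x)"]) (auto simp: iid_sample_def)
  have int: "integrable M (\<lambda>w. exp (s (X i w)))" if "i \<in> {1..n}" for i
    using expectation_of_sample(1)[OF iid that] .
  have int': "integrable M (\<lambda>w. \<Prod>i=1..n. exp (s (X i w)))"
    by (rule indep_vars_integrable[OF _ ind int]) auto
  then show "integrable M (\<lambda>w. exp (\<Sum>j=1..d. s j * real (num_occ n X j w) - real n * p j * (exp (s j) - 1)))"
    by (subst Bochner_Integration.integrable_cong[OF refl eq]) auto
  have one: "(\<Sum>j=1..d. p j * exp (s j)) = 1 + u"
    using p by (simp add: u_def prob_vectors_def right_diff_distrib sum_subtractf)
  have "(\<integral>w. (\<Prod>i=1..n. exp (s (X i w))) \<partial>M) = (\<Prod>i=1..n. \<integral>w. exp (s (X i w)) \<partial>M)"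
    by (rule indep_vars_lebesgue_integral[OF _ ind int]) auto
  also have "\<dots> = (1 + u) ^ n"
    using expectation_of_sample(2)[OF iid, where f = "\<lambda>x. exp (s x)"] one by simp
  also have "\<dots> \<le> exp u ^ n"
  proof (rule power_mono[OF exp_ge_add_one_self])
    show "0 \<le> 1 + u"
      unfolding one[symmetric] using p by (intro sum_nonneg) (auto simp: prob_vectors_def)
  qed
  also have "\<dots> = exp (real n * u)" by (simp add: exp_of_nat_mult)
  finally have le: "(\<integral>w. (\<Prod>i=1..n. exp (s (X i w))) \<partial>M) \<le> exp (real n * u)" .
  have "(\<integral>w. exp (\<Sum>j=1..d. s j * real (num_occ n X j w) - real n * p j * (exp (s j) - 1)) \<partial>M)
     = exp (- (real n * u)) * (\<integral>w. (\<Prod>i=1..n. exp (s (X i w))) \<partial>M)"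
    using eq by (simp cong: Bochner_Integration.integral_cong)
  also have "\<dots> \<le> exp (- (real n * u)) * exp (real n * u)"
    using le by (intro mult_left_mono) auto
  finally show "(\<integral>w. exp (\<Sum>j=1..d. s j * real (num_occ n X j w) - real n * p j * (exp (s j) - 1)) \<partial>M) \<le> 1"
    by (simp add: exp_minus)
qed

lemma sets_sum_num_occ:
  fixes g :: "nat \<Rightarrow> nat \<Rightarrow> real"
  assumes "iid_sample M d n p X"
  shows "{w \<in> space M. (\<Sum>j=1..d. g j (num_occ n X j w)) \<ge> c} \<in> sets M"
proof -
  have [measurable]: "num_occ n X j \<in> M \<rightarrow>\<^sub>M count_space UNIV" for j
    by (rule num_occ_measurable[OF assms])
  show ?thesis by measurable
qed

text \<open>Dominating each \<open>exp (g j x)\<close> by a finite mixture of the functions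
  \<open>exp (s * x - \<lambda> * (exp s - 1))\<close> reduces exponential moments of
  the dependent counts to a product of total weights.\<close>

lemma deviation_by_mixture:
  fixes g :: "nat \<Rightarrow> nat \<Rightarrow> real" and v s :: "nat \<Rightarrow> 'k \<Rightarrow> real"
  assumes iid: "iid_sample M d n p X" and p: "p \<in> prob_vectors d"
    and K: "finite K" and v: "\<And>j k. j \<in> {1..d} \<Longrightarrow> k \<in> K \<Longrightarrow> 0 \<le> v j k"
    and A: "\<And>j. j \<in> {1..d} \<Longrightarrow> (\<Sum>k\<in>K. v j k) \<le> A" and A0: "0 < A"
    and g: "\<And>j x. j \<in> {1..d} \<Longrightarrow> x \<le> n \<Longrightarrow>
      exp (g j x) \<le> (\<Sum>k\<in>K. v j k * exp (s j k * real x - real n * p j * (exp (s j k) - 1)))"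
  shows "measure M {w \<in> space M. (\<Sum>j=1..d. g j (num_occ n X j w)) \<ge> real d * ln A + t} \<le> exp (- t)"
proof -
  interpret prob_space M using iid by (simp add: iid_sample_def)
  define e where "e r j w = s j (r j) * real (num_occ n X j w) - real n * p j * (exp (s j (r j)) - 1)"
    for r :: "nat \<Rightarrow> 'k" and j w
  define R where "R = PiE {1..d} (\<lambda>_. K)"
  \<comment> \<open>\<open>U\<close> is the product over cells of the dominating mixtures,
    multiplied out: \<open>r\<close> picks one tilt per cell, so each summand is a single joint
    exponential of expectation at most 1.\<close>
  define U where "U w = (\<Sum>r\<in>R. (\<Prod>j=1..d. v j (r j)) * exp (\<Sum>j=1..d. e r j w))" for w
  have finR: "finite R" unfolding R_def using K by (intro finite_PiE) auto
  have vR: "0 \<le> (\<Prod>j=1..d. v j (r j))" if "r \<in> R" for r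
    using that v by (intro prod_nonneg) (auto simp: R_def PiE_def Pi_def)
  have int: "integrable M (\<lambda>w. exp (\<Sum>j=1..d. e r j w))" for r
    unfolding e_def by (rule multinomial_mgf_le_poisson_mgf(1)[OF iid p])
  have le1: "(\<integral>w. exp (\<Sum>j=1..d. e r j w) \<partial>M) \<le> 1" for r
    unfolding e_def by (rule multinomial_mgf_le_poisson_mgf(2)[OF iid p])
  have intU: "integrable M U" unfolding U_def using int by auto
  have "(\<integral>w. U w \<partial>M) = (\<Sum>r\<in>R. (\<Prod>j=1..d. v j (r j)) * (\<integral>w. exp (\<Sum>j=1..d. e r j w) \<partial>M))"
    unfolding U_def using int by simp
  also have "\<dots> \<le> (\<Sum>r\<in>R. (\<Prod>j=1..d. v j (r j)))"
    using mult_left_mono[OF le1 vR] by (intro sum_mono) simp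
  also have "\<dots> = (\<Prod>j=1..d. \<Sum>k\<in>K. v j k)"
    unfolding R_def using K by (simp add: prod_sum_PiE)
  also have "\<dots> \<le> (\<Prod>j=1..d. A)"
    using A v by (intro prod_mono) (auto intro!: sum_nonneg)
  finally have EU: "(\<integral>w. U w \<partial>M) \<le> A ^ d" by simp
  have gU: "exp (\<Sum>j=1..d. g j (num_occ n X j w)) \<le> U w" for w
  proof -
    have "exp (\<Sum>j=1..d. g j (num_occ n X j w)) = (\<Prod>j=1..d. exp (g j (num_occ n X j w)))"
      by (simp add: exp_sum)
    also have "\<dots> \<le> (\<Prod>j=1..d. \<Sum>k\<in>K. v j k * exp (s j k * real (num_occ n X j w) - real n * p j * (exp (s j k) - 1)))"
      by (intro prod_mono conjI g num_occ_le) auto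
    also have "\<dots> = U w"
      unfolding U_def e_def R_def using K
      by (subst prod_sum_PiE) (auto simp: prod.distrib exp_sum)
    finally show ?thesis .
  qed
  have U0: "0 \<le> U w" for w using gU[of w] by (rule order_trans[rotated]) simp
  let ?c = "exp (real d * ln A + t)"
  have "measure M {w \<in> space M. (\<Sum>j=1..d. g j (num_occ n X j w)) \<ge> real d * ln A + t}
      \<le> measure M {w \<in> space M. U w \<ge> ?c}"
  proof (rule finite_measure_mono)
    show "{w \<in> space M. U w \<ge> ?c} \<in> sets M" using intU by measurable
    show "{w \<in> space M. (\<Sum>j=1..d. g j (num_occ n X j w)) \<ge> real d * ln A + t} \<subseteq> {w \<in> space M. U w \<ge> ?c}"
      using gU by (auto intro: order_trans[rotated])
  qed
  also have "\<dots> \<le> (\<integral>w. U w \<partial>M) / ?c"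
    using intU U0 by (intro integral_Markov_inequality_measure[where A = "{}"]) auto
  also have "\<dots> \<le> A ^ d / ?c" using EU by (intro divide_right_mono) auto
  also have "\<dots> = exp (- t)"
    using A0 by (simp add: exp_add exp_of_nat_mult exp_minus field_simps)
  finally show ?thesis .
qed

subsection \<open>Pointwise bounds\<close>

lemma exp_le_quadratic:
  fixes s :: real
  assumes "- 1 \<le> s" "s \<le> 1"
  shows "exp s \<le> 1 + s + s\<^sup>2"
proof (cases "0 \<le> s")
  case True
  then show ?thesis using assms exp_bound by blast
next
  case False
  define t where "t = - s"
  have t: "0 \<le> t" "t \<le> 1" using False assms by (auto simp: t_def)
  have pos: "0 < 1 + t + t\<^sup>2 / 2" using t by (simp add: add_pos_nonneg)
  \<comment> \<open>For negative arguments, the reciprocal of the quadratic Taylor lower bound for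
    \<open>exp t\<close> is compared with \<open>1 - t + t\<^sup>2\<close>.\<close>
  have "1 \<le> (1 - t + t\<^sup>2) * (1 + t + t\<^sup>2 / 2)"
  proof -
    have "(1 - t + t\<^sup>2) * (1 + t + t\<^sup>2 / 2) = 1 + t\<^sup>2 / 2 + t ^ 3 / 2 + t ^ 4 / 2"
      by (simp add: field_simps power2_eq_square power3_eq_cube power4_eq_xxxx)
    then show ?thesis using t by simp
  qed
  then have "1 / (1 + t + t\<^sup>2 / 2) \<le> 1 - t + t\<^sup>2"
    using pos by (simp add: divide_le_eq)
  moreover have "exp (- t) \<le> 1 / (1 + t + t\<^sup>2 / 2)"
    using exp_lower_Taylor_quadratic[OF t(1)] pos by (simp add: exp_minus field_simps)
  ultimately show ?thesis by (simp add: t_def)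
qed

text \<open>The summand of the Kullback-Leibler divergence of measures that need not have total mass 1.\<close>

definition kl_div :: "real \<Rightarrow> real \<Rightarrow> real" where
  "kl_div \<mu> y = \<mu> * ln (\<mu> / y) - \<mu> + y"

lemma kl_div_le_chi_square:
  assumes "0 \<le> \<mu>" "0 < y"
  shows "kl_div \<mu> y \<le> (y - \<mu>)\<^sup>2 / y"
proof (cases "\<mu> = 0")
  case False
  then have "ln (\<mu> / y) \<le> \<mu> / y - 1"
    using assms by (intro ln_le_minus_one) simp
  then have "\<mu> * ln (\<mu> / y) \<le> \<mu> * (\<mu> / y - 1)"
    using assms by (intro mult_left_mono) auto
  also have "\<dots> = (y - \<mu>)\<^sup>2 / y + \<mu> - y"
    using assms by (simp add: field_simps power2_eq_square)
  finally show ?thesis by (simp add: kl_div_def)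
qed (use assms in \<open>simp add: kl_div_def power2_eq_square\<close>)

lemma kl_div_le_ln:
  assumes "1 \<le> y" "y \<le> \<mu>"
  shows "kl_div \<mu> y \<le> \<mu> * ln \<mu>"
proof -
  have "\<mu> * ln (\<mu> / y) \<le> \<mu> * ln \<mu>"
    using assms by (intro mult_left_mono ln_mono) (auto simp: divide_le_eq)
  then show ?thesis using assms unfolding kl_div_def by linarith
qed

section \<open>Bulk cells: exponential moment of the chi-square loss\<close>

definition chi_sq :: "real \<Rightarrow> nat \<Rightarrow> real" where
  "chi_sq \<mu> x = (real x + 1 - \<mu>)\<^sup>2 / (real x + 1)"

text \<open>With y = x + 1, the linear gain \<open>s * (y - \<mu>)\<close> is chi/8, while the
  quadratic cost \<open>\<mu> * s\<^sup>2\<close> is at most \<open>4 * y * s\<^sup>2\<close>, which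
  is chi/16 for this \<open>s\<close>. Passing from y to x costs \<open>s\<close>, at most
  1/8.\<close>

lemma tilt_at_bulk_point:
  assumes "0 \<le> \<mu>" "\<mu> / 4 \<le> real x + 1"
  defines "s \<equiv> (real x + 1 - \<mu>) / (8 * (real x + 1))"
  shows "chi_sq \<mu> x / 16 - 1 / 8 \<le> s * real x - \<mu> * (exp s - 1)"
proof -
  define y where "y = real x + 1"
  have y: "0 < y" by (simp add: y_def)
  have s: "s = (y - \<mu>) / (8 * y)" by (simp add: s_def y_def)
  have s1: "s \<le> 1 / 8" using assms y by (simp add: s divide_le_eq)
  have s2: "- 1 \<le> s" using assms y by (simp add: s le_divide_eq y_def)
  have h: "chi_sq \<mu> x = (y - \<mu>)\<^sup>2 / y" by (simp add: chi_sq_def y_def)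
  have h0: "0 \<le> chi_sq \<mu> x" using y by (simp add: h)
  have "\<mu> * (exp s - 1) \<le> \<mu> * (s + s\<^sup>2)"
    using exp_le_quadratic[OF s2] s1 assms by (intro mult_left_mono) auto
  moreover have "\<mu> * s\<^sup>2 \<le> 4 * y * s\<^sup>2"
    using assms by (intro mult_right_mono) (auto simp: y_def)
  moreover have "4 * y * s\<^sup>2 = chi_sq \<mu> x / 16"
    using y by (simp add: s h field_simps power2_eq_square)
  moreover have "s * (y - \<mu>) = chi_sq \<mu> x / 8"
    using y by (simp add: s h field_simps power2_eq_square)
  moreover have "s * real x - \<mu> * (s + s\<^sup>2) = s * (y - \<mu>) - s - \<mu> * s\<^sup>2"
    by (simp add: y_def algebra_simps)
  ultimately show ?thesis using s1 by linarith
qed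

text \<open>On either side of \<open>\<mu>\<close>, the tilt belonging to the point closest to \<open>\<mu>\<close> at which
  \<^term>\<open>chi_sq \<mu>\<close> reaches level \<open>k\<close> works for all points of that level,
  so one tilt per level and side suffices.\<close>

lemma level_tilt_exists:
  assumes "0 \<le> \<mu>"
  shows "\<exists>s. \<forall>x\<le>n. \<mu> / 4 \<le> real x + 1 \<and> (real x + 1 \<ge> \<mu>) = b \<and> real k \<le> chi_sq \<mu> x \<longrightarrow>
    real k / 16 - 1 / 8 \<le> s * real x - \<mu> * (exp s - 1)"
proof -
  define S where "S = {x. x \<le> n \<and> \<mu> / 4 \<le> real x + 1 \<and> (real x + 1 \<ge> \<mu>) = b \<and> real k \<le> chi_sq \<mu> x}"
  show ?thesis
  proof (cases "S = {}")
    case True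
    then show ?thesis unfolding S_def by blast
  next
    case False
    have fin: "finite S" unfolding S_def by simp
    define z where "z = (if b then Min S else Max S)"
    define s where "s = (real z + 1 - \<mu>) / (8 * (real z + 1))"
    have z: "z \<in> S" using fin False by (simp add: z_def)
    have at_z: "chi_sq \<mu> z / 16 - 1 / 8 \<le> s * real z - \<mu> * (exp s - 1)"
      unfolding s_def using z assms by (intro tilt_at_bulk_point) (auto simp: S_def)
    have level: "real k \<le> chi_sq \<mu> z" using z by (simp add: S_def)
    \<comment> \<open>The tilt has the sign of the side of \<mu> on which \<open>z\<close> lies, so
      \<open>s * x\<close> can only grow as x moves away from \<mu>.\<close>
    have extremal: "s * real z \<le> s * real x" if "x \<in> S" for x
    proof (cases b)
      case True
      then have "z \<le> x" using that fin by (simp add: z_def)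
      moreover have "0 \<le> s" using True z by (simp add: s_def S_def)
      ultimately show ?thesis by (intro mult_left_mono) auto
    next
      case False
      then have "x \<le> z" using that fin by (simp add: z_def)
      moreover have "s \<le> 0" using False z by (simp add: s_def S_def divide_nonpos_pos)
      ultimately show ?thesis by (intro mult_left_mono_neg) auto
    qed
    have "real k / 16 - 1 / 8 \<le> s * real x - \<mu> * (exp s - 1)" if "x \<in> S" for x
      using at_z level extremal[OF that] by linarith
    then show ?thesis unfolding S_def by blast
  qed
qed

text \<open>The factor 1/32 is half the rate 1/16 supplied by the tilts; the other half makes the
  weights of the levels summable.\<close>

definition bulk_loss :: "real \<Rightarrow> nat \<Rightarrow> real" where
  "bulk_loss \<mu> x = (if \<mu> / 4 \<le> real x + 1 then chi_sq \<mu> x / 32 else 0)"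

text \<open>At level k, the integer part of \<open>chi_sq \<mu> x\<close>, the loss is at most (k +
  1)/32 and the tilt gives at least k/16 - 1/8. The deficit 5/32 - k/32 is paid by the weight
  \<open>3 * exp (- 1 / 32) ^ k\<close>. Since \<open>\<mu> \<le> n\<close>, no level exceeds
  \<open>(n + 1)\<^sup>2\<close>.\<close>

lemma exp_bulk_le_mixture:
  assumes "0 \<le> \<mu>" "\<mu> \<le> real n"
  shows "\<exists>s. \<forall>x\<le>n. exp (bulk_loss \<mu> x) \<le> (\<Sum>k\<in>{..(n + 1)\<^sup>2} \<times> (UNIV :: bool set).
    3 * exp (- 1 / 32) ^ fst k * exp (s k * real x - \<mu> * (exp (s k) - 1)))"
proof -
  have "\<forall>k b. \<exists>s. \<forall>x\<le>n. \<mu> / 4 \<le> real x + 1 \<and> (real x + 1 \<ge> \<mu>) = b \<and> real k \<le> chi_sq \<mu> x \<longrightarrow>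
    real k / 16 - 1 / 8 \<le> s * real x - \<mu> * (exp s - 1)"
    using level_tilt_exists[OF assms(1)] by blast
  then obtain t where t: "\<And>k b x. x \<le> n \<Longrightarrow> \<mu> / 4 \<le> real x + 1 \<Longrightarrow> (real x + 1 \<ge> \<mu>) = b \<Longrightarrow>
      real k \<le> chi_sq \<mu> x \<Longrightarrow> real k / 16 - 1 / 8 \<le> t k b * real x - \<mu> * (exp (t k b) - 1)"
    by metis
  \<comment> \<open>Level 0 gets the zero tilt, whose exponential is constantly 1; it covers points
    outside the bulk and those with \<open>chi_sq \<mu> x < 1\<close>.\<close>
  define s where "s k = (if fst k = 0 then 0 else t (fst k) (snd k))" for k :: "nat \<times> bool"
  have e3: "exp (5 / 32 :: real) \<le> 3"
    using exp_le by (rule order_trans[rotated]) simp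
  show ?thesis
  proof (intro exI[of _ s] allI impI)
    fix x assume x: "x \<le> n"
    let ?f = "\<lambda>k. 3 * exp (- 1 / 32) ^ fst k * exp (s k * real x - \<mu> * (exp (s k) - 1))"
    have "\<exists>k\<in>{..(n + 1)\<^sup>2} \<times> UNIV. exp (bulk_loss \<mu> x) \<le> ?f k"
    proof (cases "\<mu> / 4 \<le> real x + 1 \<and> chi_sq \<mu> x \<ge> 1")
      case False
      then have "bulk_loss \<mu> x \<le> 5 / 32" by (auto simp: bulk_loss_def)
      then have "exp (bulk_loss \<mu> x) \<le> 3" using e3 by (meson exp_le_cancel_iff order_trans)
      then show ?thesis by (intro bexI[of _ "(0, True)"]) (auto simp: s_def)
    next
      case True
      define k where "k = nat \<lfloor>chi_sq \<mu> x\<rfloor>"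
      have k: "1 \<le> k" "real k \<le> chi_sq \<mu> x" "chi_sq \<mu> x \<le> real k + 1"
        using True unfolding k_def by linarith+
      have "chi_sq \<mu> x \<le> (real x + 1 - \<mu>)\<^sup>2"
        unfolding chi_sq_def by (simp add: divide_le_eq mult_le_cancel_left1)
      also have "\<dots> \<le> (real n + 1)\<^sup>2"
        using assms x by (intro abs_le_square_iff[THEN iffD1]) auto
      finally have "real k \<le> real ((n + 1)\<^sup>2)" using k by (simp add: add.commute)
      then have kn: "k \<le> (n + 1)\<^sup>2" by (simp only: of_nat_le_iff)
      let ?b = "real x + 1 \<ge> \<mu>"
      let ?m = "t k ?b * real x - \<mu> * (exp (t k ?b) - 1)"
      have "real k / 16 - 1 / 8 \<le> ?m"
        using t[OF x] True k by blast
      then have "bulk_loss \<mu> x \<le> 5 / 32 + real k * (- 1 / 32) + ?m"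
        using True k by (simp add: bulk_loss_def)
      then have "exp (bulk_loss \<mu> x) \<le> exp (5 / 32 + real k * (- 1 / 32) + ?m)" by simp
      also have "\<dots> = exp (5 / 32) * exp (- 1 / 32) ^ k * exp ?m"
        by (simp only: exp_add exp_of_nat_mult)
      also have "\<dots> \<le> 3 * exp (- 1 / 32) ^ k * exp ?m"
        using e3 by (intro mult_right_mono) auto
      finally show ?thesis using k kn by (intro bexI[of _ "(k, ?b)"]) (auto simp: s_def)
    qed
    then obtain k where k: "k \<in> {..(n + 1)\<^sup>2} \<times> UNIV" "exp (bulk_loss \<mu> x) \<le> ?f k" by blast
    have "?f k \<le> (\<Sum>k\<in>{..(n + 1)\<^sup>2} \<times> UNIV. ?f k)"
      using k by (intro member_le_sum) auto
    then show "exp (bulk_loss \<mu> x) \<le> (\<Sum>k\<in>{..(n + 1)\<^sup>2} \<times> UNIV. ?f k)"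
      using k by linarith
  qed
qed

text \<open>The ratio is at most 32/33, so the geometric sum is at most 33; the factor 3 and the two
  sides give 198.\<close>

lemma bulk_weights_le: "(\<Sum>k\<in>{..m :: nat} \<times> (UNIV :: bool set). 3 * exp (- 1 / 32 :: real) ^ fst k) \<le> 200"
proof -
  define r where "r = exp (- 1 / 32 :: real)"
  have "1 + 1 / 32 \<le> exp (1 / 32 :: real)" by (rule exp_ge_add_one_self)
  then have r: "r \<le> 32 / 33" "0 < r" by (auto simp: r_def exp_minus field_simps)
  have "(1 - r) * (\<Sum>i\<le>m. r ^ i) = 1 - r ^ Suc m" by (rule sum_gp_basic)
  then have "(1 - r) * (\<Sum>i\<le>m. r ^ i) \<le> 1" using r by simp
  moreover have "1 / 33 * (\<Sum>i\<le>m. r ^ i) \<le> (1 - r) * (\<Sum>i\<le>m. r ^ i)"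
    using r by (intro mult_right_mono sum_nonneg) auto
  ultimately have "(\<Sum>i\<le>m. r ^ i) \<le> 33" by linarith
  moreover have "(\<Sum>k\<in>{..m} \<times> (UNIV :: bool set). 3 * r ^ fst k) = 6 * (\<Sum>i\<le>m. r ^ i)"
    by (simp add: sum.cartesian_product' UNIV_bool sum_distrib_left)
  ultimately show ?thesis by (simp add: r_def)
qed

section \<open>Sparse cells: moderate mean and far too few occurrences\<close>

definition sparse_loss :: "real \<Rightarrow> real \<Rightarrow> real \<Rightarrow> nat \<Rightarrow> real" where
  "sparse_loss \<theta> T \<mu> x = (if \<mu> \<le> T \<and> real x + 1 < \<mu> / 4 then \<theta> * (\<mu> * ln \<mu>) else 0)"

text \<open>The tilt \<open>- ln 2\<close> halves the Poisson mean and gains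
  \<open>\<mu> / 2 - ln 2 * x\<close>. As x is below \<mu>/4, this is at least (1/2 - 25/144)
  \<mu>.\<close>

lemma tilt_at_sparse_point:
  assumes "real x + 1 < \<mu> / 4"
  shows "3 * \<mu> / 10 \<le> - ln 2 * real x - \<mu> * (exp (- ln 2) - 1)"
proof -
  have "ln 2 * real x \<le> 25 / 36 * (\<mu> / 4)"
    using ln2_le_25_over_36 assms by (intro mult_mono) auto
  then have "3 * \<mu> / 10 \<le> \<mu> / 2 - ln 2 * real x"
    using assms of_nat_0_le_iff[of x, where 'a = real] by linarith
  then show ?thesis by (simp add: exp_minus)
qed

text \<open>Since \<open>\<theta> \<mu> ln \<mu> \<le> \<mu> / 10\<close>, weight \<open>50 \<theta>\<close> on a single tilt is enough; this makes the
  exponential moment \<open>1 + O(\<theta>)\<close> rather than \<open>O(1)\<close>.\<close>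

lemma exp_sparse_le_mixture:
  assumes "exp 1 \<le> T" and \<theta>: "\<theta> = 1 / (10 * ln T)"
  shows "exp (sparse_loss \<theta> T \<mu> x) \<le> 1 + 50 * \<theta> * exp (- ln 2 * real x - \<mu> * (exp (- ln 2) - 1))"
proof -
  have T: "0 < T" using assms(1) by (rule less_le_trans[OF exp_gt_zero])
  have lnT: "1 \<le> ln T" using assms(1) T by (subst ln_ge_iff)
  have \<theta>0: "0 < \<theta>" using lnT by (simp add: \<theta>)
  show ?thesis
  proof (cases "\<mu> \<le> T \<and> real x + 1 < \<mu> / 4")
    case False
    then show ?thesis using \<theta>0 by (auto simp: sparse_loss_def)
  next
    case True
    then have \<mu>: "1 < \<mu>" by auto
    define y where "y = \<theta> * (\<mu> * ln \<mu>)"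
    have ln: "0 \<le> ln \<mu>" "ln \<mu> \<le> \<mu>" "ln \<mu> \<le> ln T"
      using \<mu> True ln_le_minus_one[of \<mu>] by auto
    have "y = \<mu> / 10 * (ln \<mu> / ln T)" using lnT by (simp add: y_def \<theta>)
    also have "\<dots> \<le> \<mu> / 10 * 1"
      using ln lnT \<mu> by (intro mult_left_mono) (auto simp: divide_le_eq)
    finally have y1: "y \<le> \<mu> / 10" by simp
    have "y \<le> \<theta> * (\<mu> * \<mu>)"
      unfolding y_def using \<theta>0 \<mu> ln by (intro mult_left_mono) auto
    \<comment> \<open>The available exponent 3/10 is split as 1/5 + 1/10: the first share absorbs
      \<open>\<mu> * \<mu>\<close>, the second absorbs \<open>exp y\<close>.\<close>
    moreover have "\<mu> * \<mu> \<le> 50 * exp (\<mu> / 5)"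
      using exp_lower_Taylor_quadratic[of "\<mu> / 5"] \<mu> by (simp add: power2_eq_square)
    ultimately have y2: "y \<le> \<theta> * (50 * exp (\<mu> / 5))"
      using \<theta>0 by (meson mult_left_mono less_imp_le order_trans)
    have y0: "0 \<le> y" using \<theta>0 \<mu> ln by (simp add: y_def)
    \<comment> \<open>The resulting bound \<open>exp y \<le> 1 + y * exp y\<close> keeps a factor y,
      hence a factor \<theta>, in the excess over 1.\<close>
    have "exp y * (1 - y) \<le> exp y * exp (- y)"
      using exp_ge_add_one_self[of "- y"] by (intro mult_left_mono) auto
    then have "exp y \<le> 1 + y * exp y" by (simp add: exp_minus algebra_simps)
    also have "\<dots> \<le> 1 + \<theta> * (50 * exp (\<mu> / 5)) * exp (\<mu> / 10)"
      using y0 y1 y2 by (intro add_left_mono mult_mono) auto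
    also have "\<dots> = 1 + 50 * \<theta> * exp (3 * \<mu> / 10)" by (simp add: exp_add[symmetric])
    also have "\<dots> \<le> 1 + 50 * \<theta> * exp (- ln 2 * real x - \<mu> * (exp (- ln 2) - 1))"
      using tilt_at_sparse_point[of x \<mu>] True \<theta>0 by (intro add_left_mono mult_left_mono) auto
    finally show ?thesis using True by (simp add: sparse_loss_def y_def)
  qed
qed

subsection \<open>Deviation of the divergence\<close>

text \<open>Rescaling the estimator by (n + d)/n costs \<open>ln (1 + d / n) \<le> d / n\<close>.
  This is exactly matched by the linear terms of \<open>kl_div\<close>, which sum to -n + (n + d) =
  d before division by n.\<close>

lemma KL_laplace_le:
  fixes N :: "nat \<Rightarrow> nat"
  assumes p: "p \<in> prob_vectors d" and N: "(\<Sum>j=1..d. N j) = n" and n: "0 < n"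
  shows "KL d p (\<lambda>j. (real (N j) + 1) / (real n + real d))
    \<le> ereal ((\<Sum>j=1..d. kl_div (real n * p j) (real (N j) + 1)) / real n)"
proof -
  let ?q = "\<lambda>j. (real (N j) + 1) / (real n + real d)"
  have p0: "0 \<le> p j" if "j \<in> {1..d}" for j using p that by (auto simp: prob_vectors_def)
  have p1: "(\<Sum>j=1..d. p j) = 1" using p by (simp add: prob_vectors_def)
  have "ln (1 + real d / real n) \<le> real d / real n"
    by (rule ln_add_one_self_le_self) simp
  moreover have "1 + real d / real n = (real n + real d) / real n"
    using n by (simp add: field_simps)
  ultimately have lnd: "ln ((real n + real d) / real n) \<le> real d / real n" by simp
  have tm: "KL_term (p j) (?q j) = ereal (p j * ln (p j / ?q j))" for j
    using n by (auto simp: KL_term_def add_nonneg_eq_0_iff)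
  have pj: "p j * ln (p j / ?q j)
      = p j * ln ((real n + real d) / real n) + p j * ln (real n * p j / (real (N j) + 1))"
    if "j \<in> {1..d}" for j
  proof (cases "p j = 0")
    case False
    then have pos: "0 < p j" using p0[OF that] by simp
    have "p j / ?q j = (real n + real d) / real n * (real n * p j / (real (N j) + 1))"
      using n by (simp add: mult.commute)
    then have "ln (p j / ?q j)
        = ln ((real n + real d) / real n) + ln (real n * p j / (real (N j) + 1))"
      using n pos by (simp only:) (subst ln_mult_pos, auto intro!: divide_pos_pos add_pos_nonneg)
    then show ?thesis by (simp add: distrib_left)
  qed simp
  let ?S = "\<Sum>j=1..d. p j * ln (real n * p j / (real (N j) + 1))"
  have "KL d p ?q = ereal (\<Sum>j=1..d. p j * ln (p j / ?q j))"
    by (simp add: KL_def tm)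
  also have "(\<Sum>j=1..d. p j * ln (p j / ?q j)) = ln ((real n + real d) / real n) + ?S"
    using pj p1 by (simp add: sum.distrib sum_distrib_right[symmetric])
  finally have KL: "KL d p ?q = ereal (ln ((real n + real d) / real n) + ?S)" .
  have "(\<Sum>j=1..d. kl_div (real n * p j) (real (N j) + 1))
      = real n * ?S - real n * (\<Sum>j=1..d. p j) + (real (\<Sum>j=1..d. N j) + real d)"
    by (simp add: kl_div_def sum.distrib sum_subtractf sum_distrib_left mult.assoc)
  also have "\<dots> = real n * ?S + real d" unfolding p1 N by simp
  finally have "(\<Sum>j=1..d. kl_div (real n * p j) (real (N j) + 1)) / real n = ?S + real d / real n"
    using n by (simp add: add_divide_distrib)
  then show ?thesis unfolding KL using lnd by simp
qed

text \<open>The last premise excludes a mean above \<open>T\<close> with fewer than a quarter of the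
  expected occurrences, where both losses vanish.\<close>

lemma kl_div_le_bulk_plus_sparse:
  assumes "0 \<le> \<mu>" "0 < \<theta>" "\<mu> \<le> T \<or> \<mu> / 4 \<le> real x + 1"
  shows "kl_div \<mu> (real x + 1) \<le> 32 * bulk_loss \<mu> x + sparse_loss \<theta> T \<mu> x / \<theta>"
proof (cases "\<mu> / 4 \<le> real x + 1")
  case True
  then have "32 * bulk_loss \<mu> x = chi_sq \<mu> x" "sparse_loss \<theta> T \<mu> x = 0"
    by (auto simp: bulk_loss_def sparse_loss_def)
  then show ?thesis
    using kl_div_le_chi_square[of \<mu> "real x + 1"] assms by (simp add: chi_sq_def)
next
  case False
  then show ?thesis
    using kl_div_le_ln[of "real x + 1" \<mu>] assms by (simp add: bulk_loss_def sparse_loss_def)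
qed

section \<open>Tail bounds for both losses, and a union bound for cells of large mean\<close>

lemma bulk_deviation:
  assumes iid: "iid_sample M d n p X" and p: "p \<in> prob_vectors d"
  shows "measure M {w \<in> space M. (\<Sum>j=1..d. bulk_loss (real n * p j) (num_occ n X j w)) \<ge> real d * ln 200 + t}
    \<le> exp (- t)"
proof -
  have p01: "0 \<le> p j" "p j \<le> 1" if "j \<in> {1..d}" for j
    using p that member_le_sum[of j "{1..d}" p] by (auto simp: prob_vectors_def)
  have "\<forall>j\<in>{1..d}. \<exists>s. \<forall>x\<le>n. exp (bulk_loss (real n * p j) x) \<le> (\<Sum>k\<in>{..(n + 1)\<^sup>2} \<times> (UNIV :: bool set).
    3 * exp (- 1 / 32) ^ fst k * exp (s k * real x - real n * p j * (exp (s k) - 1)))"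
    using p01 by (intro ballI exp_bulk_le_mixture) (auto intro: mult_left_le)
  then obtain s where "\<forall>j\<in>{1..d}. \<forall>x\<le>n. exp (bulk_loss (real n * p j) x)
      \<le> (\<Sum>k\<in>{..(n + 1)\<^sup>2} \<times> (UNIV :: bool set).
    3 * exp (- 1 / 32) ^ fst k * exp (s j k * real x - real n * p j * (exp (s j k) - 1)))"
    by (auto simp: bchoice_iff)
  then have s: "exp (bulk_loss (real n * p j) x) \<le> (\<Sum>k\<in>{..(n + 1)\<^sup>2} \<times> (UNIV :: bool set).
    3 * exp (- 1 / 32) ^ fst k * exp (s j k * real x - real n * p j * (exp (s j k) - 1)))"
    if "j \<in> {1..d}" "x \<le> n" for j x
    using that by blast
  show ?thesis
    by (rule deviation_by_mixture[OF iid p _ _ bulk_weights_le _ s]) simp_all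
qed

lemma sparse_deviation:
  assumes iid: "iid_sample M d n p X" and p: "p \<in> prob_vectors d"
    and T: "exp 1 \<le> T" and \<theta>: "\<theta> = 1 / (10 * ln T)"
  shows "measure M {w \<in> space M. (\<Sum>j=1..d. sparse_loss \<theta> T (real n * p j) (num_occ n X j w))
      \<ge> real d * ln (1 + 50 * \<theta>) + t} \<le> exp (- t)"
proof -
  have "0 < T" using T by (rule less_le_trans[OF exp_gt_zero])
  then have "1 \<le> ln T" using T by (subst ln_ge_iff)
  then have \<theta>0: "0 < \<theta>" by (simp add: \<theta>)
  show ?thesis
  proof (rule deviation_by_mixture[OF iid p, where K = UNIV and s = "\<lambda>_ b. if b then - ln 2 else 0"
        and v = "\<lambda>_ b. if b then 50 * \<theta> else 1"])
    show "exp (sparse_loss \<theta> T (real n * p j) x) \<le> (\<Sum>b\<in>UNIV. (if b then 50 * \<theta> else 1) *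
        exp ((if b then - ln 2 else 0) * real x - real n * p j * (exp (if b then - ln 2 else 0) - 1)))"
      for j x
      using exp_sparse_le_mixture[OF T \<theta>, of "real n * p j" x] by (simp add: UNIV_bool)
  qed (use \<theta>0 in \<open>simp_all add: UNIV_bool\<close>)
qed

definition rare_tilt :: "real \<Rightarrow> nat \<Rightarrow> real" where
  "rare_tilt \<mu> x = - ln 2 * real x - \<mu> * (exp (- ln 2) - 1)"

text \<open>This is the Chernoff bound for one count: only cell j is tilted, and total weight 1 in
  every cell makes the term \<open>d * ln A\<close> vanish.\<close>

lemma rare_deviation:
  assumes iid: "iid_sample M d n p X" and p: "p \<in> prob_vectors d"
  shows "measure M {w \<in> space M.
      (\<Sum>i=1..d. if i = j then rare_tilt (real n * p i) (num_occ n X i w) else 0) \<ge> t} \<le> exp (- t)"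
  using deviation_by_mixture[OF iid p, where K = "UNIV :: unit set" and A = 1
      and s = "\<lambda>i _. if i = j then - ln 2 else 0" and v = "\<lambda>_ _. 1"
      and g = "\<lambda>i x. if i = j then rare_tilt (real n * p i) x else 0" and t = t]
  by (simp add: rare_tilt_def)

text \<open>Each cell is allowed failure probability \<open>exp (- t) / d\<close>. A mean above
  \<open>T\<close> suffices, because the tilt then gains
  \<open>3 * \<mu> / 10 \<ge> t + ln d\<close>.\<close>

lemma few_occurrences_prob:
  assumes iid: "iid_sample M d n p X" and p: "p \<in> prob_vectors d" and d: "0 < d"
    and T: "10 * (t + ln (real d)) \<le> 3 * T"
  obtains E where "E \<in> sets M" "measure M E \<le> exp (- t)"
    "\<And>w j. \<lbrakk>w \<in> space M - E; j \<in> {1..d}; T < real n * p j\<rbrakk>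
      \<Longrightarrow> real n * p j / 4 \<le> real (num_occ n X j w) + 1"
proof -
  interpret prob_space M using iid by (simp add: iid_sample_def)
  define F where "F j = {w \<in> space M.
    (\<Sum>i=1..d. if i = j then rare_tilt (real n * p i) (num_occ n X i w) else 0) \<ge> t + ln (real d)}" for j
  have F: "F j \<in> sets M" for j
    unfolding F_def using sets_sum_num_occ[OF iid, of "t + ln (real d)" "\<lambda>i x. if i = j then rare_tilt (real n * p i) x else 0"] .
  show thesis
  proof
    show "(\<Union>j\<in>{1..d}. F j) \<in> sets M" using F by auto
    have "measure M (\<Union>j\<in>{1..d}. F j) \<le> (\<Sum>j=1..d. measure M (F j))"
      using F by (intro measure_UNION_le) auto
    also have "\<dots> \<le> (\<Sum>j=1..d. exp (- (t + ln (real d))))"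
      unfolding F_def by (intro sum_mono rare_deviation[OF iid p])
    also have "\<dots> = exp (- t)" using d by (simp add: exp_add exp_minus field_simps exp_diff)
    finally show "measure M (\<Union>j\<in>{1..d}. F j) \<le> exp (- t)" .
  next
    fix w j assume w: "w \<in> space M - (\<Union>j\<in>{1..d}. F j)" and j: "j \<in> {1..d}" and big: "T < real n * p j"
    show "real n * p j / 4 \<le> real (num_occ n X j w) + 1"
    proof (rule ccontr)
      assume "\<not> ?thesis"
      then have "3 * (real n * p j) / 10 \<le> rare_tilt (real n * p j) (num_occ n X j w)"
        unfolding rare_tilt_def by (intro tilt_at_sparse_point) simp
      moreover have "t + ln (real d) \<le> 3 * (real n * p j) / 10"
        using T big by simp
      ultimately have "t + ln (real d) \<le> rare_tilt (real n * p j) (num_occ n X j w)"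
        by (rule order_trans[rotated])
      then have "w \<in> F j" using w j by (simp add: F_def)
      then show False using w j by blast
    qed
  qed
qed

theorem theorem1:
  fixes n d :: nat and P :: "nat \<Rightarrow> real" and \<delta> :: real
    and M :: "'w measure" and X :: "nat \<Rightarrow> 'w \<Rightarrow> nat"
  assumes "n \<ge> 12" and "d \<ge> 2"
    and "P \<in> prob_vectors d"
    and "iid_sample M d n P X"
    and "\<delta> \<in> {exp (- real n / 6) <..< exp (- 2)}"
  shows "measure M {w \<in> space M.
           KL d P (laplace_estimator d n X w)
             \<ge> ereal (110000 * ((real d + ln (1 / \<delta>) * ln (ln (1 / \<delta>))) / real n))}
         \<le> 4 * \<delta>"
proof -
  note p = assms(3) and iid = assms(4)
  interpret prob_space M using iid by (simp add: iid_sample_def)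
  define L where "L = ln (1 / \<delta>)"
  define T where "T = 4 * (L + ln (real d))"
  define \<theta> where "\<theta> = 1 / (10 * ln T)"
  have n: "0 < n" using assms by simp
  have \<delta>: "0 < \<delta>" using assms(5) by (auto intro: less_trans[OF exp_gt_zero])
  have eL: "exp (- L) = \<delta>" using \<delta> by (simp add: L_def ln_div)
  have "exp (- L) < exp (- 2)" using assms(5) by (simp add: eL)
  then have L2: "2 < L" by simp
  have d1: "0 \<le> ln (real d)" using assms by simp
  have T8: "8 \<le> T" using L2 d1 by (simp add: T_def)
  have Te: "exp 1 \<le> T" using T8 exp_le by linarith
  have lnT: "1 \<le> ln T" using T8 Te by (subst ln_ge_iff) auto
  have \<theta>0: "0 < \<theta>" using lnT by (simp add: \<theta>_def)

  have lnL: "ln 2 \<le> ln L" using L2 by simp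
  have half: "1 / 2 \<le> ln L" using lnL ln2_ge_two_thirds by linarith
  \<comment> \<open>Factoring out L makes d enter the bound on \<open>ln T\<close> only through
    \<open>ln d / L\<close>, so \<open>L * ln T\<close> costs an additive
    \<open>ln d \<le> d\<close> instead of \<open>L * ln d\<close>.\<close>
  have "T = (4 * L) * (1 + ln (real d) / L)" using L2 by (simp add: T_def field_simps)
  then have "ln T = ln 4 + ln L + ln (1 + ln (real d) / L)"
    using L2 d1 by (simp add: ln_mult_pos add_pos_nonneg)
  moreover have "ln (1 + ln (real d) / L) \<le> ln (real d) / L"
    using L2 d1 by (intro ln_add_one_self_le_self) auto
  moreover have "ln 4 = 2 * ln (2 :: real)" using ln_realpow[of 2 2] by simp
  ultimately have "ln T \<le> 3 * ln L + ln (real d) / L" using lnL by linarith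
  then have "L * ln T \<le> L * (3 * ln L + ln (real d) / L)"
    using L2 by (intro mult_left_mono) auto
  also have "\<dots> = 3 * (L * ln L) + ln (real d)" using L2 by (simp add: field_simps)
  also have "\<dots> \<le> 3 * (L * ln L) + real d" using ln_le_minus_one[of "real d"] assms by simp
  finally have LlnT: "L * ln T \<le> 3 * (L * ln L) + real d" .
  have "L * (1 / 2) \<le> L * ln L" using L2 half by (intro mult_left_mono) auto
  then have LL: "L \<le> 2 * (L * ln L)" by simp

  \<comment> \<open>Here a, b, c, l stand for d, \<open>L * ln T\<close>, \<open>L * ln L\<close>
    and L; the left side is at most 6428 a + 94 c.\<close>
  have arith: "32 * (a * 199 + l) + (50 * a + 10 * b) \<le> 110000 * (a + c)"
    if "b \<le> 3 * c + a" "l \<le> 2 * c" "0 \<le> l" "0 \<le> a" for a b c l :: real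
    using that by simp

  define E1 where "E1 = {w \<in> space M. (\<Sum>j=1..d. bulk_loss (real n * P j) (num_occ n X j w)) \<ge> real d * ln 200 + L}"
  define E2 where "E2 = {w \<in> space M. (\<Sum>j=1..d. sparse_loss \<theta> T (real n * P j) (num_occ n X j w))
      \<ge> real d * ln (1 + 50 * \<theta>) + L}"
  have E1: "E1 \<in> sets M" "measure M E1 \<le> \<delta>"
    unfolding E1_def eL[symmetric]
    by (rule sets_sum_num_occ[OF iid, of _ "\<lambda>j. bulk_loss (real n * P j)"], rule bulk_deviation[OF iid p])
  have E2: "E2 \<in> sets M" "measure M E2 \<le> \<delta>"
    unfolding E2_def eL[symmetric]
    by (rule sets_sum_num_occ[OF iid, of _ "\<lambda>j. sparse_loss \<theta> T (real n * P j)"],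
        rule sparse_deviation[OF iid p Te \<theta>_def])
  have d0: "0 < d" using assms by simp
  have T_ge: "10 * (L + ln (real d)) \<le> 3 * T" using L2 d1 by (simp add: T_def)
  obtain E3 where E3: "E3 \<in> sets M" "measure M E3 \<le> \<delta>"
    and large: "\<And>w j. \<lbrakk>w \<in> space M - E3; j \<in> {1..d}; T < real n * P j\<rbrakk>
      \<Longrightarrow> real n * P j / 4 \<le> real (num_occ n X j w) + 1"
    using few_occurrences_prob[OF iid p d0 T_ge] unfolding eL by metis

  let ?B = "{w \<in> space M. KL d P (laplace_estimator d n X w)
    \<ge> ereal (110000 * ((real d + ln (1 / \<delta>) * ln (ln (1 / \<delta>))) / real n))}"
  have "?B \<subseteq> E1 \<union> E2 \<union> E3"
  proof (rule subsetI, rule ccontr)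
    fix w assume w: "w \<in> ?B" and good: "w \<notin> E1 \<union> E2 \<union> E3"
    then have sp: "w \<in> space M" by simp
    let ?N = "\<lambda>j. num_occ n X j w"
    let ?D = "\<Sum>j=1..d. kl_div (real n * P j) (real (?N j) + 1)"
    let ?b = "\<Sum>j=1..d. bulk_loss (real n * P j) (?N j)"
    let ?s = "\<Sum>j=1..d. sparse_loss \<theta> T (real n * P j) (?N j)"
    have "real (\<Sum>j=1..d. ?N j) = real n"
      using sum_num_occ[OF iid sp, of "\<lambda>_. 1"] by simp
    then have "(\<Sum>j=1..d. ?N j) = n" by (simp only: of_nat_eq_iff)
    then have "KL d P (laplace_estimator d n X w) \<le> ereal (?D / real n)"
      unfolding laplace_estimator_def[abs_def] by (rule KL_laplace_le[OF p _ n])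
    then have "110000 * ((real d + L * ln L) / real n) \<le> ?D / real n"
      using w unfolding L_def by (auto dest: order_trans)
    then have lower: "110000 * (real d + L * ln L) \<le> ?D"
      using n by (simp add: divide_le_cancel)
    have "?D \<le> (\<Sum>j=1..d. 32 * bulk_loss (real n * P j) (?N j) + sparse_loss \<theta> T (real n * P j) (?N j) / \<theta>)"
    proof (intro sum_mono kl_div_le_bulk_plus_sparse \<theta>0)
      fix j assume j: "j \<in> {1..d}"
      then show "0 \<le> real n * P j" using p by (simp add: prob_vectors_def)
      show "real n * P j \<le> T \<or> real n * P j / 4 \<le> real (?N j) + 1"
        using large[OF _ j] sp good by fastforce
    qed
    also have "\<dots> = 32 * ?b + ?s / \<theta>"
      by (simp add: sum.distrib sum_distrib_left sum_divide_distrib)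
    also have "\<dots> < 32 * (real d * ln 200 + L) + (real d * ln (1 + 50 * \<theta>) + L) / \<theta>"
      using good sp \<theta>0 by (intro add_strict_mono divide_strict_right_mono) (auto simp: E1_def E2_def)
    \<comment> \<open>The bound \<open>ln (1 + 50 * \<theta>) \<le> 50 * \<theta>\<close> cancels
      the division by \<theta>, so the d-term of the sparse part carries no factor
      \<open>ln T\<close>.\<close>
    also have "\<dots> \<le> 32 * (real d * 199 + L) + (real d * (50 * \<theta>) + L) / \<theta>"
      using ln_le_minus_one[of 200] ln_add_one_self_le_self[of "50 * \<theta>"] \<theta>0
      by (intro add_mono divide_right_mono mult_left_mono) auto
    also have "(real d * (50 * \<theta>) + L) / \<theta> = 50 * real d + 10 * (L * ln T)"
      using \<theta>0 lnT by (simp add: add_divide_distrib) (simp add: \<theta>_def)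
    also have "32 * (real d * 199 + L) + (50 * real d + 10 * (L * ln T)) \<le> 110000 * (real d + L * ln L)"
      by (rule arith[OF LlnT LL]) (use L2 in auto)
    finally show False using lower by linarith
  qed
  then have "measure M ?B \<le> measure M (E1 \<union> E2 \<union> E3)"
    using E1 E2 E3 by (intro finite_measure_mono) auto
  also have "\<dots> \<le> measure M E1 + measure M E2 + measure M E3"
    using measure_Un_le[of "E1 \<union> E2" M E3] measure_Un_le[of E1 M E2] E1 E2 E3 by auto
  also have "\<dots> \<le> 4 * \<delta>" using E1 E2 E3 \<delta> by linarith
  finally show ?thesis .
qed

end
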